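(* Let $p$ be a prime, $q=p^f$ with $f\ge1$, let $k\mid q-1$, and let $A_k=\{x^k:x\in\mathbb{F}_q^\times\}\le\mathbb{F}_q^\times$ have order $t=(q-1)/k>1$. Suppose that $p^e\equiv r\pmod t$ for integers $e\ge1$ and $r$, where $r\neq1$ and $p\nmid r$. Put $$M(r)=\begin{cases} r-1,& r\ge2,\\ 2|r|,& r\le-1.\end{cases}$$ Then $|(A_k-a)\cap(A_k-b)|\le M(r)$ for all $a,b\in\mathbb{F}_q$ with $a\ne b$. Every decomposition $A_k=S+T$ with $S,T\subseteq\mathbb{F}_q$ and $|S|,|T|\ge2$ therefore satisfies $|S|\le M(r)$ and $|T|\le M(r)$. Consequently, if $t>M(r)^2$, then $A_k$ is additively irreducible.
   Context: $A-a=\{x-a:x\in A\}$ and $S+T=\{s+u:s\in S,\ u\in T\}$, both in the additive group of $\mathbb{F}_q$. A set $A\subseteq\mathbb{F}_q$ is additively irreducible if there are no sets $S,T$ with $|S|,|T|\ge2$ and $A=S+T$. *)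

theory Defs
  imports
    "HOL-Number_Theory.Number_Theory"
    "HOL-Library.Set_Algebras"
    "HOL-Library.Cardinality"
begin

definition kth_powers :: "nat \<Rightarrow> 'a::finite_field set" where
  "kth_powers k = {x ^ k | x. x \<noteq> 0}"

definition translate_minus :: "'a::finite_field set \<Rightarrow> 'a \<Rightarrow> 'a set" where
  "translate_minus A a = {x - a | x. x \<in> A}"

text \<open>
  The sum of two sets is the Minkowski sum from \<^theory>\<open>HOL-Library.Set_Algebras\<close>.
  Since the field is finite, \<^const>\<open>card\<close> is the true cardinality of every set here.
\<close>

definition additively_irreducible :: "'a::finite_field set \<Rightarrow> bool" where
  "additively_irreducible A \<longleftrightarrow> \<not> (\<exists>S T. card S \<ge> 2 \<and> card T \<ge> 2 \<and> A = S + T)"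

text \<open>Only meaningful for \<open>r \<ge> 2\<close> or \<open>r \<le> -1\<close>; the values at \<open>0\<close> and \<open>1\<close> are arbitrary.\<close>

definition M :: "int \<Rightarrow> int" where
  "M r = (if r \<ge> 2 then r - 1 else 2 * \<bar>r\<bar>)"

end

theory Submission
  imports Defs "HOL-Computational_Algebra.Polynomial"
begin

text \<open>
  An element of \<open>(A - a) \<inter> (A - b)\<close> amounts to an \<open>x\<close> such that \<open>x\<close> and \<open>x + c\<close> lie in \<open>A\<close>, where
  \<open>c = b - a \<noteq> 0\<close>. Both are \<open>t\<close>-th roots of unity, so their \<open>p^e\<close>-th powers are their
  \<open>r\<close>-th powers, and additivity of the Frobenius map gives \<open>(x + c)^r = x^r + c^(p^e)\<close>. For \<open>r \<ge> 2\<close>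
  this is a polynomial equation in \<open>x\<close> whose coefficient at \<open>x^(r-1)\<close> is \<open>r c \<noteq> 0\<close>; for \<open>r = -s < 0\<close>
  clearing denominators gives one of degree \<open>2s\<close>. The degree bounds the number of solutions, and
  two distinct elements of \<open>T\<close> place \<open>S\<close> inside an intersection of two translates of \<open>A\<close>.
\<close>

lemma card_shifted_power_eq_le:
  fixes c d :: "'a::idom"
  assumes "n \<ge> 2" and "of_nat n \<noteq> (0::'a)" and "c \<noteq> 0"
  shows "card {x. (x + c) ^ n = x ^ n + d} \<le> n - 1"
proof -
  define P where "P = [:c, 1:] ^ n - monom 1 n - [:d:]"
  \<comment> \<open>The terms of degree \<open>n\<close> cancel, which makes this the top
    coefficient; \<open>n \<ge> 2\<close> keeps the constant \<open>d\<close> out of it.\<close>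
  have "coeff P (n - 1) = of_nat n * c"
    using assms(1) coeff_linear_poly_power[of "n - 1" n c 1] binomial_symmetric[of "n - 1" n]
    by (auto simp: P_def coeff_pCons split: nat.split)
  with assms have "P \<noteq> 0"
    by auto
  moreover have "degree P \<le> n - 1"
  proof (rule degree_le, intro allI impI)
    fix i assume i: "i > n - 1"
    show "coeff P i = 0"
    proof (cases "i = n")
      case True
      with assms(1) show ?thesis
        by (simp add: P_def coeff_linear_power coeff_pCons split: nat.split)
    next
      case False
      with i have "coeff ([:c, 1:] ^ n) i = 0"
        by (intro coeff_eq_0) (simp add: degree_linear_power)
      with False i assms(1) show ?thesis
        by (simp add: P_def coeff_pCons split: nat.split)
    qed
  qed
  moreover have "{x. (x + c) ^ n = x ^ n + d} = {x. poly P x = 0}"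
    by (auto simp: P_def poly_monom add.commute algebra_simps)
  ultimately show ?thesis
    using card_poly_roots_bound[of P] by simp
qed

text \<open>Over a field, the equation below says \<open>(x + c)^(-s) = x^(-s) + d\<close> when \<open>x\<close> and \<open>x + c\<close>
  are nonzero.\<close>

lemma card_shifted_inverse_power_eq_le:
  fixes c d :: "'a::idom"
  assumes "s > 0" and "c \<noteq> 0"
  shows "card {x. x ^ s = (x + c) ^ s + d * x ^ s * (x + c) ^ s} \<le> 2 * s"
proof -
  define P where "P = [:c, 1:] ^ s + smult d (monom 1 s * [:c, 1:] ^ s) - monom 1 s"
  \<comment> \<open>The value at 0 certifies \<open>P \<noteq> 0\<close> whatever \<open>d\<close>
    is; the top coefficient would not, since \<open>d\<close> may vanish.\<close>
  have "poly P 0 = c ^ s"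
    using assms(1) by (simp add: P_def poly_monom)
  with assms(2) have "P \<noteq> 0"
    by auto
  moreover have "degree P \<le> 2 * s"
  proof -
    have "degree (monom 1 s * [:c, 1:] ^ s) \<le> 2 * s"
      by (rule order.trans[OF degree_mult_le]) (simp add: degree_monom_eq degree_linear_power)
    then show ?thesis
      unfolding P_def
      by (intro degree_diff_le degree_add_le order.trans[OF degree_smult_le])
        (simp_all add: degree_monom_eq degree_linear_power)
  qed
  moreover have "{x. x ^ s = (x + c) ^ s + d * x ^ s * (x + c) ^ s} = {x. poly P x = 0}"
    by (auto simp: P_def poly_monom add.commute algebra_simps)
  ultimately show ?thesis
    using card_poly_roots_bound[of P] by simp
qed

lemma power_eq_power_if_cong:
  fixes x :: "'a::monoid_mult"
  assumes "x ^ t = 1" and "[m = n] (mod t)"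
  shows "x ^ m = x ^ n"
proof -
  have "x ^ i = x ^ (i mod t)" for i
    using assms(1) by (metis mod_div_decomp mult.commute power_add power_mult power_one mult_1_left)
  with assms(2) show ?thesis
    unfolding cong_def by metis
qed

text \<open>Roots of unity stand in for \<open>kth_powers k\<close>: the equation
  \<open>x ^ t = 1\<close> is what lets exponents be reduced modulo \<open>t\<close>.\<close>

lemma card_roots_of_unity_shifted_le:
  fixes c :: "'a::finite_field" and r :: int
  assumes c: "c \<noteq> 0" and p: "CHAR('a) = p"
    and cong: "[int p ^ e = r] (mod int t)" and r1: "r \<noteq> 1" and pr: "\<not> int p dvd r"
  shows "int (card {x::'a. x ^ t = 1 \<and> (x + c) ^ t = 1}) \<le> M r"
proof -
  define d where "d = c ^ (p ^ e)"
  have frob: "(x + c) ^ (p ^ e) = x ^ (p ^ e) + d" for x :: 'a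
    unfolding d_def using p by (intro freshmans_dream') auto
  have "r \<noteq> 0"
    using pr by auto
  with r1 consider "r \<ge> 2" | "r < 0"
    by linarith
  then show ?thesis
  proof cases
    case 1
    define n where "n = nat r"
    have n: "r = int n" "n \<ge> 2"
      using 1 by (auto simp: n_def)
    have "[p ^ e = n] (mod t)"
      using cong unfolding n(1) by (metis cong_int_iff of_nat_power)
    then have "{x::'a. x ^ t = 1 \<and> (x + c) ^ t = 1} \<subseteq> {x. (x + c) ^ n = x ^ n + d}"
      using frob by (auto dest!: power_eq_power_if_cong)
    \<comment> \<open>Here \<open>p\<close> not dividing \<open>r\<close> enters: the coefficient
      \<open>r c\<close> survives in characteristic \<open>p\<close>.\<close>
    moreover have "of_nat n \<noteq> (0::'a)"
      using pr n(1) p by (simp add: of_nat_eq_0_iff_char_dvd)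
    ultimately have "card {x::'a. x ^ t = 1 \<and> (x + c) ^ t = 1} \<le> n - 1"
      using card_shifted_power_eq_le[of n c d] n(2) c
      by (meson card_mono finite order.trans)
    with n show ?thesis
      by (simp add: M_def)
  next
    case 2
    define s where "s = nat (- r)"
    have s: "r = - int s" "s > 0"
      using 2 by (auto simp: s_def)
    \<comment> \<open>Adding \<open>s\<close> trades the negative exponent \<open>r\<close> for a
      congruence between naturals, so that \<open>x ^ (p ^ e)\<close> is the inverse of
      \<open>x ^ s\<close>.\<close>
    have "[int p ^ e + int s = r + int s] (mod int t)"
      using cong by (intro cong_add) auto
    then have cong0: "[p ^ e + s = 0] (mod t)"
      unfolding s(1) by (simp flip: cong_int_iff)
    have inv: "x ^ (p ^ e) * x ^ s = 1" if "x ^ t = 1" for x :: 'a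
      using power_eq_power_if_cong[OF that cong0] by (simp add: power_add)
    have "{x::'a. x ^ t = 1 \<and> (x + c) ^ t = 1}
        \<subseteq> {x. x ^ s = (x + c) ^ s + d * x ^ s * (x + c) ^ s}"
    proof safe
      fix x :: 'a assume x: "x ^ t = 1" "(x + c) ^ t = 1"
      \<comment> \<open>The inserted factor is 1; expanding its Frobenius power produces
        \<open>x ^ (p ^ e) * x ^ s\<close>, which is again 1.\<close>
      have "x ^ s = x ^ s * ((x + c) ^ (p ^ e) * (x + c) ^ s)"
        using inv[OF x(2)] by simp
      also have "\<dots> = (x ^ (p ^ e) * x ^ s) * (x + c) ^ s + d * x ^ s * (x + c) ^ s"
        unfolding frob by (simp add: algebra_simps)
      finally show "x ^ s = (x + c) ^ s + d * x ^ s * (x + c) ^ s"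
        using inv[OF x(1)] by simp
    qed
    then have "card {x::'a. x ^ t = 1 \<and> (x + c) ^ t = 1} \<le> 2 * s"
      using card_shifted_inverse_power_eq_le[of s c d] s(2) c
      by (meson card_mono finite order.trans)
    with s show ?thesis
      by (simp add: M_def)
  qed
qed

lemma kth_powers_root_of_unity:
  fixes x :: "'a::finite_field"
  assumes "x \<in> kth_powers k" and "k * t = CARD('a) - 1"
  shows "x ^ t = 1"
proof -
  obtain y :: 'a where y: "x = y ^ k" "y \<noteq> 0"
    using assms(1) by (auto simp: kth_powers_def)
  have "y * y ^ (CARD('a) - 1) = y"
    using finite_field_power_card_eq_same[of y] by (simp flip: power_Suc)
  with y assms(2) show ?thesis
    by (simp flip: power_mult)
qed

text \<open>The fibres of \<open>x ^ k\<close> cover the nonzero elements, and each has at most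
  \<open>k\<close> points, being the zeros of a polynomial of degree \<open>k\<close>. This supplies
  \<open>t \<le> card A\<close> for the irreducibility claim.\<close>

lemma card_kth_powers_ge:
  assumes "k > 0"
  shows "CARD('a::finite_field) - 1 \<le> card (kth_powers k :: 'a set) * k"
proof -
  have fibre: "card {x::'a. x ^ k = y} \<le> k" for y
  proof -
    have "monom 1 k - [:y:] \<noteq> 0"
      using assms by (metis degree_monom_eq degree_pCons_0 eq_iff_diff_eq_0 less_irrefl one_neq_zero)
    then have "card {x. poly (monom 1 k - [:y:]) x = 0} \<le> degree (monom 1 k - [:y:])"
      by (rule card_poly_roots_bound)
    also have "\<dots> \<le> k"
      by (intro degree_diff_le) (simp_all add: degree_monom_eq)
    finally show ?thesis
      by (simp add: poly_monom)
  qed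
  have "CARD('a) - 1 = card (UNIV - {0::'a})"
    by (simp add: card_Diff_singleton)
  also have "\<dots> \<le> card (\<Union>y\<in>(kth_powers k :: 'a set). {x. x ^ k = y})"
    by (intro card_mono) (auto simp: kth_powers_def)
  also have "\<dots> \<le> (\<Sum>y\<in>(kth_powers k :: 'a set). card {x. x ^ k = y})"
    by (intro card_UN_le) auto
  also have "\<dots> \<le> card (kth_powers k :: 'a set) * k"
    using sum_bounded_above[of "kth_powers k :: 'a set" "\<lambda>y. card {x. x ^ k = y}" k] fibre by simp
  finally show ?thesis .
qed

lemma mem_translate_minus_iff: "z \<in> translate_minus A a \<longleftrightarrow> z + a \<in> A"
  unfolding translate_minus_def by force

lemma card_summand_le:
  fixes S T :: "'a::finite_field set"
  assumes "card T \<ge> 2"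
    and bound: "\<And>a b. a \<noteq> b \<Longrightarrow>
      int (card (translate_minus (S + T) a \<inter> translate_minus (S + T) b)) \<le> m"
  shows "int (card S) \<le> m"
proof -
  obtain a b where ab: "a \<in> T" "b \<in> T" "a \<noteq> b"
    using assms(1) by (metis One_nat_def card_le_Suc0_iff_eq finite not_less_eq_eq numeral_2_eq_2)
  have "S \<subseteq> translate_minus (S + T) u" if "u \<in> T" for u
    using that by (auto simp: mem_translate_minus_iff intro: set_plus_intro)
  with ab have "card S \<le> card (translate_minus (S + T) a \<inter> translate_minus (S + T) b)"
    by (intro card_mono) auto
  with bound[OF ab(3)] show ?thesis
    by linarith
qed

theorem theorem1p5:
  fixes p f q k t e :: nat and r :: int and A :: "'a::finite_field set"
  assumes "prime p" and "f \<ge> 1" and "q = p ^ f" and "CARD('a) = q"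
    and "k dvd q - 1" and "A = kth_powers k"
    and "t = (q - 1) div k" and "t > 1"
    and "e \<ge> 1" and "[int p ^ e = r] (mod int t)"
    and "r \<noteq> 1" and "\<not> int p dvd r"
  shows "(\<forall>a b :: 'a. a \<noteq> b \<longrightarrow>
            int (card (translate_minus A a \<inter> translate_minus A b)) \<le> M r)
       \<and> (\<forall>S T :: 'a set. card S \<ge> 2 \<and> card T \<ge> 2 \<and> A = S + T \<longrightarrow>
            int (card S) \<le> M r \<and> int (card T) \<le> M r)
       \<and> (int t > (M r)\<^sup>2 \<longrightarrow> additively_irreducible A)"
proof -
  have "CHAR('a) dvd p ^ f"
    using CHAR_dvd_CARD[where ?'a = 'a] assms(3,4) by simp
  then have char: "CHAR('a) = p"
    using assms(1) by (metis CHAR_prime prime_dvd_power primes_dvd_imp_eq)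
  have kt: "k * t = CARD('a) - 1"
    using assms(4,5,7) by simp
  \<comment> \<open>Division by 0 yields 0, so \<open>k = 0\<close> would force
    \<open>t = 0\<close>.\<close>
  have "k > 0"
    using assms(7,8) by (cases "k = 0") auto
  have inter: "int (card (translate_minus A a \<inter> translate_minus A b)) \<le> M r" if "a \<noteq> b" for a b
  proof -
    \<comment> \<open>Substituting \<open>x = z + a\<close> turns the pair \<open>z + a\<close>,
      \<open>z + b\<close> into \<open>x\<close>, \<open>x + (b - a)\<close>.\<close>
    have "translate_minus A a \<inter> translate_minus A b
        \<subseteq> (\<lambda>x. x - a) ` {x. x ^ t = 1 \<and> (x + (b - a)) ^ t = 1}"
    proof
      fix z assume z: "z \<in> translate_minus A a \<inter> translate_minus A b"
      then have "z + a \<in> A" "z + b \<in> A"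
        by (simp_all add: mem_translate_minus_iff)
      then have "(z + a) ^ t = 1" "((z + a) + (b - a)) ^ t = 1"
        using kth_powers_root_of_unity[OF _ kt] assms(6) by auto
      then show "z \<in> (\<lambda>x. x - a) ` {x. x ^ t = 1 \<and> (x + (b - a)) ^ t = 1}"
        by (intro image_eqI[of _ _ "z + a"]) auto
    qed
    then have "card (translate_minus A a \<inter> translate_minus A b)
        \<le> card {x. x ^ t = 1 \<and> (x + (b - a)) ^ t = 1}"
      by (meson card_image_le card_mono finite order.trans)
    moreover have "int (card {x. x ^ t = 1 \<and> (x + (b - a)) ^ t = 1}) \<le> M r"
      using that by (intro card_roots_of_unity_shifted_le[OF _ char assms(10,11,12)]) auto
    ultimately show ?thesis
      by linarith
  qed
  have summands: "int (card S) \<le> M r \<and> int (card T) \<le> M r"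
    if "card S \<ge> 2" "card T \<ge> 2" "A = S + T" for S T :: "'a set"
    \<comment> \<open>Addition of sets commutes, so either summand can play either role.\<close>
    using card_summand_le[of T S] card_summand_le[of S T] inter that
    by (simp add: add.commute)
  have "additively_irreducible A" if large: "int t > (M r)\<^sup>2"
    unfolding additively_irreducible_def
  proof (intro notI, elim exE conjE)
    fix S T :: "'a set" assume ST: "card S \<ge> 2" "card T \<ge> 2" "A = S + T"
    \<comment> \<open>The contradiction comes from
      \<open>t \<le> card A \<le> card S * card T \<le> (M r)\<^sup>2\<close>.\<close>
    have "t * k \<le> card A * k"
      using card_kth_powers_ge[OF \<open>k > 0\<close>, where ?'a = 'a] kt assms(6) by (simp add: mult.commute)
    then have "t \<le> card A"
      using \<open>k > 0\<close> by simp
    also have "card A \<le> card (S \<times> T)"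
      unfolding ST(3) set_plus_image by (rule card_image_le) simp
    finally have "int t \<le> int (card S) * int (card T)"
      by (metis card_cartesian_product of_nat_le_iff of_nat_mult)
    also have "\<dots> \<le> (M r)\<^sup>2"
      unfolding power2_eq_square using summands[OF ST] by (intro mult_mono) auto
    finally show False
      using large by simp
  qed
  with inter summands show ?thesis
    by blast
qed

end
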